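(* Let $(V,\omega)$ be a $2n$-dimensional real symplectic vector space and let $f$ and $g$ be positive-definite quadratic forms on $V$, with associated linear maps $F,G:V\to V$. Then $f$ and $g$ Poisson commute, i.e. $\{f,g\}=0$, if and only if there exist a basis $\{x_1,\dots,x_n,y_1,\dots,y_n\}$ of $V$ that is symplectic (in the sense $\omega(y_j,x_k)=\delta_{jk}$, $\omega(x_j,x_k)=\omega(y_j,y_k)=0$ for all $j,k$) and real numbers $\mu_j,\gamma_j>0$ ($1\le j\le n$) such that for all $j=1,\dots,n$ $$Fx_j=-\mu_j y_j,\quad Fy_j=\mu_j x_j,\qquad Gx_j=-\gamma_j y_j,\quad Gy_j=\gamma_j x_j .$$ Here $\{\pm i\mu_1,\dots,\pm i\mu_n\}$ and $\{\pm i\gamma_1,\dots,\pm i\gamma_n\}$ are lists of all eigenvalues of $F$ and of $G$ respectively, each eigenvalue repeated according to its multiplicity. Moreover, for $v=\sum_{j=1}^n(s_jx_j+t_jy_j)\in V$ with $s_j,t_j\in\mathbb{R}$, one has $$f(v)=\sum_{j=1}^n\mu_j(s_j^2+t_j^2),\qquad g(v)=\sum_{j=1}^n\gamma_j(s_j^2+t_j^2).$$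
   Context: For a quadratic form $f$ on $V$, let $A$ be the unique symmetric bilinear form with $f(v)=A(v,v)$, and let $F:V\to V$ be the unique linear map with $A(v,w)=\omega(v,Fw)$ for all $v,w\in V$. Similarly, for $g$ let $B$ be its symmetric bilinear form and $G:V\to V$ the linear map with $B(v,w)=\omega(v,Gw)$. Eigenvalues of $F$ and $G$ are those of their complex-linear extensions to the complexification $V^{\mathbb{C}}$. The Poisson bracket of smooth functions on $V$ is the standard one, $\{f,g\}=\omega(X_f,X_g)$, where the Hamiltonian vector field $X_f$ is defined by $\omega(X_f,\cdot)=df$ (the overall sign convention is immaterial). *)

theory Defs
  imports "HOL-Analysis.Analysis" "HOL-Library.Multiset"
begin

text \<open>
  A finite-dimensional real vector space is modelled by a type of class \<^class>\<open>euclidean_space\<close>.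
  Its inner product is an auxiliary choice which none of the definitions below mentions; it only
  supplies the topology with respect to which derivatives are taken.
\<close>

definition symplectic_form :: "('a::euclidean_space \<Rightarrow> 'a \<Rightarrow> real) \<Rightarrow> bool" where
  "symplectic_form \<omega> \<longleftrightarrow>
     bilinear \<omega> \<and> (\<forall>v. \<omega> v v = 0) \<and> (\<forall>v. (\<forall>w. \<omega> v w = 0) \<longrightarrow> v = 0)"

definition quadratic_form :: "('a::euclidean_space \<Rightarrow> real) \<Rightarrow> bool" where
  "quadratic_form f \<longleftrightarrow> (\<exists>A. bilinear A \<and> (\<forall>v. f v = A v v))"

definition pos_def_quadratic_form :: "('a::euclidean_space \<Rightarrow> real) \<Rightarrow> bool" where
  "pos_def_quadratic_form f \<longleftrightarrow> quadratic_form f \<and> (\<forall>v. v \<noteq> 0 \<longrightarrow> f v > 0)"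

definition assoc_form :: "('a::euclidean_space \<Rightarrow> real) \<Rightarrow> 'a \<Rightarrow> 'a \<Rightarrow> real" where
  "assoc_form f = (THE A. bilinear A \<and> (\<forall>v w. A v w = A w v) \<and> (\<forall>v. f v = A v v))"

definition assoc_map ::
  "('a::euclidean_space \<Rightarrow> 'a \<Rightarrow> real) \<Rightarrow> ('a \<Rightarrow> real) \<Rightarrow> 'a \<Rightarrow> 'a" where
  "assoc_map \<omega> f = (THE F. linear F \<and> (\<forall>v w. assoc_form f v w = \<omega> v (F w)))"

definition hamiltonian_vf ::
  "('a::euclidean_space \<Rightarrow> 'a \<Rightarrow> real) \<Rightarrow> ('a \<Rightarrow> real) \<Rightarrow> 'a \<Rightarrow> 'a" where
  "hamiltonian_vf \<omega> f v = (THE u. \<forall>w. \<omega> u w = frechet_derivative f (at v) w)"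

definition poisson ::
  "('a::euclidean_space \<Rightarrow> 'a \<Rightarrow> real) \<Rightarrow> ('a \<Rightarrow> real) \<Rightarrow> ('a \<Rightarrow> real) \<Rightarrow> 'a \<Rightarrow> real" where
  "poisson \<omega> f g v = \<omega> (hamiltonian_vf \<omega> f v) (hamiltonian_vf \<omega> g v)"

text \<open>
  The vectors are not required to be pairwise distinct, since this already follows from the
  values of \<open>\<omega>\<close> on them.
\<close>

definition symplectic_basis ::
  "('a::euclidean_space \<Rightarrow> 'a \<Rightarrow> real) \<Rightarrow> nat \<Rightarrow> (nat \<Rightarrow> 'a) \<Rightarrow> (nat \<Rightarrow> 'a) \<Rightarrow> bool" where
  "symplectic_basis \<omega> n x y \<longleftrightarrow>
     independent (x ` {1..n} \<union> y ` {1..n}) \<and> span (x ` {1..n} \<union> y ` {1..n}) = UNIV \<and>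
     (\<forall>j\<in>{1..n}. \<forall>k\<in>{1..n}.
        \<omega> (y j) (x k) = (if j = k then 1 else 0) \<and> \<omega> (x j) (x k) = 0 \<and> \<omega> (y j) (y k) = 0)"

text \<open>
  The complexification of \<open>V\<close> is \<open>V \<times> V\<close>, with \<open>(u, v)\<close> standing for \<open>u + \<i> v\<close>.
\<close>

definition cscale :: "complex \<Rightarrow> 'a::real_vector \<times> 'a \<Rightarrow> 'a \<times> 'a" where
  "cscale c w = (Re c *\<^sub>R fst w - Im c *\<^sub>R snd w, Re c *\<^sub>R snd w + Im c *\<^sub>R fst w)"

definition complexify :: "('a::real_vector \<Rightarrow> 'a) \<Rightarrow> 'a \<times> 'a \<Rightarrow> 'a \<times> 'a" where
  "complexify F = map_prod F F"

definition eigenvalue :: "('a::real_vector \<Rightarrow> 'a) \<Rightarrow> complex \<Rightarrow> bool" where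
  "eigenvalue F z \<longleftrightarrow> (\<exists>w. w \<noteq> 0 \<and> complexify F w = cscale z w)"

text \<open>
  The (algebraic) multiplicity of an eigenvalue is the complex dimension of its generalized
  eigenspace.
\<close>

definition gen_eigenspace :: "('a::real_vector \<Rightarrow> 'a) \<Rightarrow> complex \<Rightarrow> ('a \<times> 'a) set" where
  "gen_eigenspace F z = {w. \<exists>k. ((\<lambda>u. complexify F u - cscale z u) ^^ k) w = 0}"

definition multiplicity_of :: "('a::real_vector \<Rightarrow> 'a) \<Rightarrow> complex \<Rightarrow> nat" where
  "multiplicity_of F z = vector_space.dim cscale (gen_eigenspace F z)"

definition eigenvalue_list :: "('a::real_vector \<Rightarrow> 'a) \<Rightarrow> complex multiset \<Rightarrow> bool" where
  "eigenvalue_list F M \<longleftrightarrow>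
     set_mset M = {z. eigenvalue F z} \<and> (\<forall>z. eigenvalue F z \<longrightarrow> count M z = multiplicity_of F z)"

definition plus_minus_i :: "nat \<Rightarrow> (nat \<Rightarrow> real) \<Rightarrow> complex multiset" where
  "plus_minus_i n \<mu> =
     image_mset (\<lambda>j. \<i> * of_real (\<mu> j)) (mset_set {1..n}) +
     image_mset (\<lambda>j. - (\<i> * of_real (\<mu> j))) (mset_set {1..n})"

definition simultaneous_normal_form ::
  "('a::euclidean_space \<Rightarrow> 'a \<Rightarrow> real) \<Rightarrow> nat \<Rightarrow> ('a \<Rightarrow> 'a) \<Rightarrow> ('a \<Rightarrow> 'a) \<Rightarrow>
   (nat \<Rightarrow> 'a) \<Rightarrow> (nat \<Rightarrow> 'a) \<Rightarrow> (nat \<Rightarrow> real) \<Rightarrow> (nat \<Rightarrow> real) \<Rightarrow> bool" where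
  "simultaneous_normal_form \<omega> n F G x y \<mu> \<gamma> \<longleftrightarrow>
     symplectic_basis \<omega> n x y \<and>
     (\<forall>j\<in>{1..n}. \<mu> j > 0 \<and> \<gamma> j > 0 \<and>
        F (x j) = - (\<mu> j *\<^sub>R y j) \<and> F (y j) = \<mu> j *\<^sub>R x j \<and>
        G (x j) = - (\<gamma> j *\<^sub>R y j) \<and> G (y j) = \<gamma> j *\<^sub>R x j)"

text \<open>The objects introduced above by definite description are well defined.\<close>

lemma vector_space_cscale: "vector_space (cscale :: complex \<Rightarrow> 'a::real_vector \<times> 'a \<Rightarrow> _)"
  by unfold_locales (auto simp: cscale_def prod_eq_iff algebra_simps)

lemma symplectic_form_represents:
  assumes "symplectic_form \<omega>" and "linear \<phi>"
  shows "\<exists>!u. \<forall>w. \<omega> u w = \<phi> w"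
proof -
  have bl: "bilinear \<omega>" and nd: "\<And>v. (\<And>w. \<omega> v w = 0) \<Longrightarrow> v = 0"
    using assms(1) by (auto simp: symplectic_form_def)
  have l1: "linear (\<omega> u)" and l2: "linear (\<lambda>u. \<omega> u w)" for u w
    using bl by (auto simp: bilinear_def)
  define T where "T = (\<lambda>u. \<Sum>b\<in>Basis. \<omega> u b *\<^sub>R b)"
  have Tb: "T u \<bullet> b = \<omega> u b" if "b \<in> Basis" for u b
    using that by (simp add: T_def inner_sum_left inner_Basis if_distrib cong: if_cong)
  have linT: "linear T"
    unfolding T_def
    by (rule linearI) (simp_all add: bilinear_ladd[OF bl] bilinear_lmul[OF bl]
        scaleR_add_left sum.distrib scaleR_sum_right)
  have ext: "\<omega> u w = \<phi> w" if "\<And>b. b \<in> Basis \<Longrightarrow> \<omega> u b = \<phi> b" for u w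
    using linear_eq_on_span[OF l1 assms(2), of Basis u w] that by simp
  have "inj T"
  proof (subst linear_injective_0[OF linT], intro allI impI)
    fix u assume "T u = 0"
    then have *: "\<omega> u b = 0" if "b \<in> Basis" for b
      using Tb[OF that, of u] by simp
    show "u = 0"
    proof (rule nd)
      fix w
      show "\<omega> u w = 0"
        using linear_eq_on_span[OF l1 linear_zero, of Basis u w] * by simp
    qed
  qed
  then have "surj T"
    using linT linear_injective_imp_surjective by blast
  then obtain u where u: "T u = (\<Sum>b\<in>Basis. \<phi> b *\<^sub>R b)"
    by (metis surjD)
  have "\<omega> u b = \<phi> b" if "b \<in> Basis" for b
    using Tb[OF that, of u] that unfolding u
    by (simp add: inner_sum_left inner_Basis if_distrib cong: if_cong)
  then have ex: "\<forall>w. \<omega> u w = \<phi> w"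
    using ext by blast
  have "u' = u" if "\<forall>w. \<omega> u' w = \<phi> w" for u'
  proof -
    have "u' - u = 0"
      by (rule nd) (simp add: bilinear_lsub[OF bl] that ex)
    then show ?thesis by simp
  qed
  with ex show ?thesis by blast
qed

lemma assoc_form_unique:
  assumes "quadratic_form f"
  shows "\<exists>!A. bilinear A \<and> (\<forall>v w. A v w = A w v) \<and> (\<forall>v. f v = A v v)"
proof -
  obtain A where A: "bilinear A" and fA: "\<And>v. f v = A v v"
    using assms by (auto simp: quadratic_form_def)
  define S where "S = (\<lambda>v w. (A v w + A w v) / 2)"
  have S: "bilinear S \<and> (\<forall>v w. S v w = S w v) \<and> (\<forall>v. f v = S v v)"
    by (auto simp: S_def fA bilinear_def bilinear_ladd[OF A] bilinear_radd[OF A]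
        bilinear_lmul[OF A] bilinear_rmul[OF A] field_simps intro!: linearI)
  moreover have "B = S"
    if B: "bilinear B \<and> (\<forall>v w. B v w = B w v) \<and> (\<forall>v. f v = B v v)" for B
  proof (intro ext)
    fix v w
    have polar: "2 * C v w = f (v + w) - f v - f w"
      if "bilinear C \<and> (\<forall>v w. C v w = C w v) \<and> (\<forall>v. f v = C v v)" for C
    proof -
      have C: "bilinear C" and sy: "C w v = C v w" and d: "\<And>v. f v = C v v"
        using that by auto
      show ?thesis
        by (simp add: d bilinear_ladd[OF C] bilinear_radd[OF C] sy)
    qed
    show "B v w = S v w"
      using polar[OF B] polar[OF S] by simp
  qed
  ultimately show ?thesis by blast
qed

lemma assoc_form:
  assumes "quadratic_form f"
  shows "bilinear (assoc_form f)" and "assoc_form f v w = assoc_form f w v"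
    and "f v = assoc_form f v v"
  using theI'[OF assoc_form_unique[OF assms]] unfolding assoc_form_def by blast+

lemma assoc_map_unique:
  assumes "symplectic_form \<omega>" and "quadratic_form f"
  shows "\<exists>!F. linear F \<and> (\<forall>v w. assoc_form f v w = \<omega> v (F w))"
proof -
  have bl: "bilinear \<omega>" and alt: "\<And>v. \<omega> v v = 0"
    and nd: "\<And>v. (\<And>w. \<omega> v w = 0) \<Longrightarrow> v = 0"
    using assms(1) by (auto simp: symplectic_form_def)
  note A = assoc_form(1)[OF assms(2)]
  have skew: "\<omega> v w = - \<omega> w v" for v w
  proof -
    have "\<omega> (v + w) (v + w) = \<omega> v w + \<omega> w v"
      by (simp add: bilinear_ladd[OF bl] bilinear_radd[OF bl] alt[of v] alt[of w])
    then show ?thesis using alt[of "v + w"] by simp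
  qed
  have "linear (\<lambda>v. - assoc_form f v w)" for w
    using A by (auto simp: bilinear_def intro: linear_compose_neg)
  then have "\<exists>u. \<forall>v. \<omega> u v = - assoc_form f v w" for w
    using symplectic_form_represents[OF assms(1)] by blast
  then obtain F where F: "\<And>v w. \<omega> (F w) v = - assoc_form f v w"
    by metis
  have rep: "assoc_form f v w = \<omega> v (F w)" for v w
    using F[of w v] skew[of v "F w"] by simp
  have uniq: "u = u'" if "\<And>v. \<omega> u v = \<omega> u' v" for u u'
  proof -
    have "u - u' = 0"
      by (rule nd) (simp add: bilinear_lsub[OF bl] that)
    then show ?thesis by simp
  qed
  have "linear F"
  proof (rule linearI)
    show "F (a + b) = F a + F b" for a b
      by (rule uniq) (simp add: F bilinear_ladd[OF bl] bilinear_radd[OF A])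
    show "F (c *\<^sub>R a) = c *\<^sub>R F a" for c a
      by (rule uniq) (simp add: F bilinear_lmul[OF bl] bilinear_rmul[OF A])
  qed
  moreover have "F' = F" if "\<forall>v w. assoc_form f v w = \<omega> v (F' w)" for F'
  proof
    fix w
    show "F' w = F w"
    proof (rule uniq)
      fix v
      show "\<omega> (F' w) v = \<omega> (F w) v"
        using that rep skew[of "F' w" v] skew[of "F w" v] by simp
    qed
  qed
  ultimately show ?thesis
    using rep by blast
qed

lemma assoc_map:
  assumes "symplectic_form \<omega>" and "quadratic_form f"
  shows "linear (assoc_map \<omega> f)" and "assoc_form f v w = \<omega> v (assoc_map \<omega> f w)"
  using theI'[OF assoc_map_unique[OF assms]] unfolding assoc_map_def by blast+

lemma hamiltonian_vf:
  assumes "symplectic_form \<omega>" and "f differentiable (at v)"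
  shows "\<omega> (hamiltonian_vf \<omega> f v) w = frechet_derivative f (at v) w"
  using theI'[OF symplectic_form_represents[OF assms(1) linear_frechet_derivative[OF assms(2)]]]
  unfolding hamiltonian_vf_def by blast

end

theory Submission
  imports Defs
begin

text \<open>
  For a quadratic form \<open>f\<close> the Hamiltonian vector field is \<open>v \<mapsto> - 2 F v\<close>, so
  \<open>{f, g} v = 4 \<omega> (F v) (G v)\<close>, and since \<open>F\<close> and \<open>G\<close> are \<open>\<omega>\<close>-skew this vanishes identically iff
  \<open>F\<close> and \<open>G\<close> commute. In that case both are skew for the inner product \<open>\<omega> u (F v)\<close>, so \<open>F \<circ> F\<close>
  and \<open>F \<circ> G\<close> are commuting symmetric operators. A common eigenvector \<open>x\<close>, suitably scaled,
  together with a multiple of \<open>F x\<close> spans an invariant symplectic plane in normal form, and one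
  continues in its \<open>\<omega>\<close>-orthogonal complement.
\<close>

section \<open>Symmetric operators on a subspace\<close>

text \<open>If \<open>Q x w\<close> were nonzero, \<open>Q\<close> along the line
  \<open>x + t *\<^sub>R w\<close> would start at 0 with nonzero slope and hence take a negative
  value inside \<open>W\<close>.\<close>

lemma psd_form_isotropic_imp_orthogonal:
  fixes Q :: "'a::real_vector \<Rightarrow> 'a \<Rightarrow> real"
  assumes Q: "bilinear Q" and sym: "\<And>u v. Q u v = Q v u"
    and W: "subspace W" and psd: "\<And>v. v \<in> W \<Longrightarrow> 0 \<le> Q v v"
    and x: "x \<in> W" "Q x x = 0" and w: "w \<in> W"
  shows "Q x w = 0"
proof (rule ccontr)
  assume ne: "Q x w \<noteq> 0"
  \<comment> \<open>The minimizing \<open>t\<close> would have denominator \<open>Q w w\<close>;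
    adding 1 rules out division by zero and still gives a negative value.\<close>
  define d where "d = Q w w + 1"
  have d: "d > 0" using psd[OF w] by (simp add: d_def)
  define t where "t = - Q x w / d"
  have "0 \<le> Q (x + t *\<^sub>R w) (x + t *\<^sub>R w)"
    using W x w by (intro psd) (simp add: subspace_add subspace_scale)
  also have "\<dots> = 2 * t * Q x w + t\<^sup>2 * Q w w"
    by (simp add: bilinear_ladd[OF Q] bilinear_radd[OF Q] bilinear_lmul[OF Q] bilinear_rmul[OF Q]
        sym[of w x] x power2_eq_square algebra_simps)
  also have "\<dots> = - (Q x w)\<^sup>2 * (d + 1) / d\<^sup>2"
  proof -
    have "2 * t * Q x w + t\<^sup>2 * (d - 1) = - (Q x w)\<^sup>2 * (d + 1) / d\<^sup>2"
      using d by (simp add: t_def field_simps power2_eq_square)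
    then show ?thesis by (simp add: d_def)
  qed
  also have "\<dots> < 0"
    using ne d by (simp add: divide_neg_pos)
  finally show False by simp
qed

text \<open>The eigenvector is a maximizer of the Rayleigh quotient.\<close>

lemma symmetric_operator_eigenvector:
  fixes A :: "'a::euclidean_space \<Rightarrow> 'a \<Rightarrow> real"
  assumes A: "bilinear A" and sym: "\<And>u v. A u v = A v u" and pos: "\<And>v. v \<noteq> 0 \<Longrightarrow> 0 < A v v"
    and S: "linear S" and S_sym: "\<And>u v. A (S u) v = A u (S v)"
    and W: "subspace W" and S_W: "\<And>v. v \<in> W \<Longrightarrow> S v \<in> W" and W0: "W \<noteq> {0}"
  obtains x c where "x \<in> W" "x \<noteq> 0" "S x = c *\<^sub>R x"
proof -
  have lA: "linear (A u)" for u using A by (simp add: bilinear_def)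
  define R where "R = (\<lambda>v. A (S v) v / A v v)"
  \<comment> \<open>The sphere of the auxiliary norm only supplies compactness: \<open>R\<close> is
    invariant under scaling, so a maximum on \<open>K\<close> bounds \<open>R\<close> on all nonzero
    vectors of \<open>W\<close>.\<close>
  define K where "K = W \<inter> sphere 0 1"
  have "compact K"
    unfolding K_def by (intro closed_Int_compact closed_subspace W compact_sphere)
  moreover obtain w where w: "w \<in> W" "w \<noteq> 0"
    using W0 subspace_0[OF W] by auto
  have "w /\<^sub>R norm w \<in> K"
    using w W by (simp add: K_def subspace_scale)
  then have "K \<noteq> {}" by auto
  moreover have "continuous_on K R"
  proof -
    have bb: "bounded_bilinear A" using A by (simp add: bilinear_conv_bounded_bilinear)
    have "A v v \<noteq> 0" if "v \<in> K" for v
      using that pos[of v] by (cases "v = 0") (auto simp: K_def)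
    moreover have "continuous_on K S"
      by (simp add: S linear_continuous_on linear_conv_bounded_linear[symmetric])
    ultimately show ?thesis
      unfolding R_def
      by (intro continuous_on_divide bounded_bilinear.continuous_on[OF bb] continuous_on_id) auto
  qed
  ultimately obtain x where x: "x \<in> K" and max: "\<And>v. v \<in> K \<Longrightarrow> R v \<le> R x"
    using continuous_attains_sup[of K R] by blast
  have xW: "x \<in> W" and x0: "x \<noteq> 0" using x by (auto simp: K_def)
  define c where "c = R x"
  \<comment> \<open>Maximality of \<open>R x\<close> says that \<open>Q\<close> is positive
    semidefinite on \<open>W\<close> and vanishes at \<open>x\<close>; the previous lemma then turns
    this into an eigenvector equation.\<close>
  define Q where "Q = (\<lambda>u v. c * A u v - A (S u) v)"
  have Q: "bilinear Q"
    unfolding bilinear_def Q_def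
    by (auto intro!: linearI simp: bilinear_ladd[OF A] bilinear_radd[OF A] bilinear_lmul[OF A]
        bilinear_rmul[OF A] linear_add[OF S] linear_scale[OF S] algebra_simps)
  have Q_sym: "Q u v = Q v u" for u v
    using S_sym[of u v] sym[of u "S v"] sym[of u v] by (simp add: Q_def)
  have psd: "0 \<le> Q v v" if "v \<in> W" for v
  proof (cases "v = 0")
    case True
    then show ?thesis by (simp add: bilinear_lzero[OF Q])
  next
    case False
    have "R v = R (v /\<^sub>R norm v)"
      using False by (simp add: R_def bilinear_lmul[OF A] bilinear_rmul[OF A] linear_scale[OF S])
    also have "\<dots> \<le> c"
      unfolding c_def using False that W by (intro max) (simp add: K_def subspace_scale)
    finally show ?thesis
      using pos[OF False] by (simp add: Q_def R_def field_simps)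
  qed
  have Qx: "Q x x = 0"
    using pos[OF x0] by (simp add: Q_def c_def R_def)
  \<comment> \<open>The residual is its own test vector, since \<open>Q x r = A r r\<close>.\<close>
  define r where "r = c *\<^sub>R x - S x"
  have "r \<in> W" using xW W S_W by (simp add: r_def subspace_diff subspace_scale)
  then have "Q x r = 0"
    using psd_form_isotropic_imp_orthogonal[OF Q _ W _ xW Qx] Q_sym psd by blast
  moreover have "Q x r = A r r"
    by (simp add: Q_def r_def bilinear_lsub[OF A] bilinear_lmul[OF A])
  ultimately have "r = 0" using pos[of r] by fastforce
  then show thesis using that[of x c] xW x0 by (simp add: r_def)
qed

section \<open>Diagonalizable operators\<close>

lemma (in vector_space) dim_coordinate_subspace:
  assumes fin: "finite I"
    and hom: "\<And>i. i \<in> I \<Longrightarrow> module_hom scale (*) (\<phi> i)"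
    and dual: "\<And>i k. i \<in> I \<Longrightarrow> k \<in> I \<Longrightarrow> \<phi> i (e k) = (if i = k then 1 else 0)"
    and expand: "\<And>w. w = (\<Sum>i\<in>I. scale (\<phi> i w) (e i))"
    and J: "J \<subseteq> I"
  shows "dim {w. \<forall>i\<in>I - J. \<phi> i w = 0} = card J"
proof (rule dim_unique)
  show "e ` J \<subseteq> {w. \<forall>i\<in>I - J. \<phi> i w = 0}"
    using dual J by auto
  show "{w. \<forall>i\<in>I - J. \<phi> i w = 0} \<subseteq> span (e ` J)"
  proof safe
    fix w assume w: "\<forall>i\<in>I - J. \<phi> i w = 0"
    have "w = (\<Sum>i\<in>I. scale (\<phi> i w) (e i))" by (rule expand)
    also have "\<dots> = (\<Sum>i\<in>J. scale (\<phi> i w) (e i))"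
      using w J by (intro sum.mono_neutral_right fin) auto
    also have "\<dots> \<in> span (e ` J)"
      by (intro span_sum span_scale span_base) auto
    finally show "w \<in> span (e ` J)" .
  qed
  show "independent (e ` J)"
    unfolding dependent_def
  proof safe
    fix j assume j: "j \<in> J" and sp: "e j \<in> span (e ` J - {e j})"
    interpret h: module_hom scale "(*)" "\<phi> j" using hom j J by auto
    have "\<phi> j (e k) = 0" if "k \<in> J" "e k \<noteq> e j" for k
      using that dual[of j k] j J by (cases "j = k") auto
    then have "\<phi> j (e j) = 0"
      by (intro h.eq_0_on_span[OF _ sp]) auto
    then show False using dual[of j j] j J by auto
  qed
  have "inj_on e J"
    using dual J by (intro inj_onI) (metis subsetD zero_neq_one)
  then show "card (e ` J) = card J" by (rule card_image)
qed

lemma count_image_mset_set: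
  assumes "finite I"
  shows "count (image_mset h (mset_set I)) z = card {i \<in> I. h i = z}"
proof -
  have "count (image_mset h (mset_set I)) z = (\<Sum>i\<in>h -` {z} \<inter> I. count (mset_set I) i)"
    using assms by (simp add: count_image_mset)
  also have "\<dots> = (\<Sum>i\<in>h -` {z} \<inter> I. 1)"
    using assms by (intro sum.cong) auto
  also have "\<dots> = card {i \<in> I. h i = z}"
    by (auto intro!: arg_cong[of _ _ card])
  finally show ?thesis .
qed

text \<open>In the coordinates \<open>\<phi> i\<close>, subtracting \<open>z\<close> from
  \<open>complexify F\<close> gives multiplication by \<open>l i - z\<close>. The generalized
  eigenspace of \<open>z\<close> is thus the coordinate subspace of the indices with
  \<open>l i = z\<close>, and its dimension is the multiplicity of \<open>z\<close> in the
  list.\<close>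

lemma eigenvalue_list_diagonalizable:
  fixes F :: "'a::real_vector \<Rightarrow> 'a" and \<phi> :: "'i \<Rightarrow> 'a \<times> 'a \<Rightarrow> complex"
  assumes fin: "finite I"
    and hom: "\<And>i. i \<in> I \<Longrightarrow> module_hom cscale (*) (\<phi> i)"
    and dual: "\<And>i k. i \<in> I \<Longrightarrow> k \<in> I \<Longrightarrow> \<phi> i (e k) = (if i = k then 1 else 0)"
    and expand: "\<And>w. w = (\<Sum>i\<in>I. cscale (\<phi> i w) (e i))"
    and diag: "\<And>i w. i \<in> I \<Longrightarrow> \<phi> i (complexify F w) = l i * \<phi> i w"
  shows "eigenvalue_list F (image_mset l (mset_set I))"
proof -
  interpret C: vector_space "cscale :: complex \<Rightarrow> 'a \<times> 'a \<Rightarrow> 'a \<times> 'a"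
    by (rule vector_space_cscale)
  have sub: "\<phi> i (complexify F w - cscale z w) = (l i - z) * \<phi> i w" if "i \<in> I" for i w z
  proof -
    interpret h: module_hom cscale "(*)" "\<phi> i" using hom that by auto
    show ?thesis by (simp add: h.diff h.scale diag that algebra_simps)
  qed
  have zero: "w = 0 \<longleftrightarrow> (\<forall>i\<in>I. \<phi> i w = 0)" for w
  proof
    assume "w = 0"
    then show "\<forall>i\<in>I. \<phi> i w = 0"
      using hom module_hom.zero by blast
  next
    assume "\<forall>i\<in>I. \<phi> i w = 0"
    then show "w = 0" using expand[of w] by simp
  qed
  have pow: "\<phi> i (((\<lambda>u. complexify F u - cscale z u) ^^ k) w) = (l i - z) ^ k * \<phi> i w"
    if "i \<in> I" for i w z k
    by (induction k) (simp_all add: sub that)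
  have gen: "gen_eigenspace F z = {w. \<forall>i\<in>I - {i \<in> I. l i = z}. \<phi> i w = 0}" for z
  proof (intro set_eqI iffI)
    fix w assume "w \<in> gen_eigenspace F z"
    then show "w \<in> {w. \<forall>i\<in>I - {i \<in> I. l i = z}. \<phi> i w = 0}"
      using pow by (fastforce simp: gen_eigenspace_def zero)
  next
    fix w assume "w \<in> {w. \<forall>i\<in>I - {i \<in> I. l i = z}. \<phi> i w = 0}"
    \<comment> \<open>The exponent 1 suffices: each coordinate of \<open>w\<close> either vanishes
      or is multiplied by \<open>l i - z = 0\<close>.\<close>
    then have "((\<lambda>u. complexify F u - cscale z u) ^^ 1) w = 0"
      by (subst zero) (auto simp: sub)
    then show "w \<in> gen_eigenspace F z"
      unfolding gen_eigenspace_def by blast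
  qed
  have mult: "multiplicity_of F z = count (image_mset l (mset_set I)) z" for z
    unfolding multiplicity_of_def gen count_image_mset_set[OF fin]
    by (rule C.dim_coordinate_subspace[OF fin hom dual expand]) auto
  have "eigenvalue F z \<longleftrightarrow> z \<in> l ` I" for z
  proof
    assume "eigenvalue F z"
    then obtain w where "w \<noteq> 0" and w: "complexify F w = cscale z w"
      by (auto simp: eigenvalue_def)
    then obtain i where i: "i \<in> I" "\<phi> i w \<noteq> 0" using zero by blast
    have "(l i - z) * \<phi> i w = \<phi> i 0" using sub[OF i(1), of w z] w by simp
    then have "l i = z" using i zero[of 0] by simp
    then show "z \<in> l ` I" using i by auto
  next
    assume "z \<in> l ` I"
    then obtain i where i: "i \<in> I" "z = l i" by auto
    have "e i \<noteq> 0" using dual[of i i] i zero[of "e i"] by (metis zero_neq_one)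
    moreover have "complexify F (e i) - cscale z (e i) = 0"
      using i by (subst zero) (auto simp: sub dual)
    ultimately show "eigenvalue F z" by (metis eigenvalue_def right_minus_eq)
  qed
  then show ?thesis
    using fin by (auto simp: eigenvalue_list_def mult)
qed

section \<open>Quadratic Hamiltonians on a symplectic vector space\<close>

locale symplectic_space =
  fixes \<omega> :: "'a::euclidean_space \<Rightarrow> 'a \<Rightarrow> real"
  assumes symplectic: "symplectic_form \<omega>"
begin

lemma bilin: "bilinear \<omega>" and alt [simp]: "\<omega> v v = 0"
  using symplectic by (auto simp: symplectic_form_def)

lemmas omega_simps = bilinear_ladd[OF bilin] bilinear_radd[OF bilin] bilinear_lmul[OF bilin]
  bilinear_rmul[OF bilin] bilinear_lneg[OF bilin] bilinear_rneg[OF bilin]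
  bilinear_lsub[OF bilin] bilinear_rsub[OF bilin] bilinear_lzero[OF bilin] bilinear_rzero[OF bilin]

lemma linear_left: "linear (\<lambda>v. \<omega> v w)" and linear_right: "linear (\<omega> v)"
  using bilin by (auto simp: bilinear_def)

lemma skew: "\<omega> v w = - \<omega> w v"
proof -
  have "\<omega> (v + w) (v + w) = \<omega> v w + \<omega> w v" 
    by (simp add: bilinear_ladd[OF bilin] bilinear_radd[OF bilin] del: alt) simp
  then show ?thesis using alt[of "v + w"] by linarith
qed

lemma nondegenerate: "(\<And>u. \<omega> u v = \<omega> u w) \<Longrightarrow> v = w"
proof -
  assume *: "\<And>u. \<omega> u v = \<omega> u w"
  have "\<omega> (v - w) u = 0" for u
    using *[of u] skew[of v u] skew[of w u] by (simp add: omega_simps)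
  then have "v - w = 0"
    using symplectic unfolding symplectic_form_def by blast
  then show "v = w" by simp
qed

section \<open>Associated maps and the Poisson bracket\<close>

lemma assoc_map_skew:
  assumes "quadratic_form f"
  shows "\<omega> (assoc_map \<omega> f v) w = - \<omega> v (assoc_map \<omega> f w)"
  using assoc_map(2)[OF symplectic assms, of w v] assoc_map(2)[OF symplectic assms, of v w]
    assoc_form(2)[OF assms, of v w] skew[of "assoc_map \<omega> f v" w] by linarith

lemma quadratic_form_eq:
  assumes "quadratic_form f"
  shows "f v = \<omega> v (assoc_map \<omega> f v)"
  using assoc_form(3)[OF assms] assoc_map(2)[OF symplectic assms] by simp

text \<open>The derivative of \<open>f\<close> at \<open>v\<close> is
  \<open>2 * assoc_form f v w\<close>, which equals \<open>2 * \<omega> w (F v)\<close> for the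
  associated map \<open>F\<close>; moving \<open>F v\<close> to the first slot produces the minus
  sign.\<close>

lemma hamiltonian_vf_quadratic:
  assumes f: "quadratic_form f"
  shows "hamiltonian_vf \<omega> f v = - 2 *\<^sub>R assoc_map \<omega> f v"
proof -
  note A = assoc_form[OF f]
  have bb: "bounded_bilinear (assoc_form f)" using A(1) by (simp add: bilinear_conv_bounded_bilinear)
  have "((\<lambda>v. assoc_form f v v) has_derivative (\<lambda>w. assoc_form f v w + assoc_form f w v)) (at v)"
    by (rule bounded_bilinear.FDERIV[OF bb has_derivative_ident has_derivative_ident])
  then have d: "(f has_derivative (\<lambda>w. 2 * assoc_form f v w)) (at v)"
    using A(2)[of _ v] by (simp flip: A(3))
  show ?thesis
  proof (rule nondegenerate)
    fix u
    have "\<omega> (hamiltonian_vf \<omega> f v) u = 2 * assoc_form f v u"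
      unfolding hamiltonian_vf[OF symplectic differentiableI[OF d]]
      by (simp flip: frechet_derivative_at[OF d])
    also have "\<dots> = 2 * \<omega> u (assoc_map \<omega> f v)"
      using A(2)[of v u] assoc_map(2)[OF symplectic f, of u v] by simp
    finally show "\<omega> u (hamiltonian_vf \<omega> f v) = \<omega> u (- 2 *\<^sub>R assoc_map \<omega> f v)"
      using skew[of u "hamiltonian_vf \<omega> f v"] by (simp add: omega_simps)
  qed
qed

text \<open>Polarizing the quadratic form \<open>\<omega> (F v) (G v)\<close> yields
  \<open>\<omega> u (G (F w) - F (G w))\<close>, so nondegeneracy turns its vanishing into
  commutation.\<close>

lemma poisson_commute_iff:
  assumes f: "quadratic_form f" and g: "quadratic_form g"
  defines "F \<equiv> assoc_map \<omega> f" and "G \<equiv> assoc_map \<omega> g"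
  shows "(\<forall>v. poisson \<omega> f g v = 0) \<longleftrightarrow> (\<forall>v. F (G v) = G (F v))"
proof -
  have lin: "linear F" "linear G"
    unfolding F_def G_def using assoc_map(1)[OF symplectic] f g by auto
  have sF: "\<omega> (F v) w = - \<omega> v (F w)" and sG: "\<omega> (G v) w = - \<omega> v (G w)" for v w
    unfolding F_def G_def using f g by (auto intro: assoc_map_skew)
  have P: "poisson \<omega> f g v = 4 * \<omega> (F v) (G v)" for v
    using f g by (simp add: poisson_def hamiltonian_vf_quadratic F_def G_def omega_simps)
  show ?thesis
  proof safe
    fix w assume "\<forall>v. poisson \<omega> f g v = 0"
    then have z: "\<omega> (F v) (G v) = 0" for v by (simp add: P)
    show "F (G w) = G (F w)"
    proof (rule nondegenerate)
      fix u
      have "\<omega> (F u) (G w) + \<omega> (F w) (G u) = 0"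
        using z[of "u + w"] z[of u] z[of w]
        by (simp add: linear_add[OF lin(1)] linear_add[OF lin(2)] omega_simps)
      moreover have "\<omega> (F w) (G u) = \<omega> u (G (F w))"
        using skew[of "F w" "G u"] sG by simp
      ultimately show "\<omega> u (F (G w)) = \<omega> u (G (F w))"
        using sF[of u "G w"] by simp
    qed
  next
    fix v assume c: "\<forall>v. F (G v) = G (F v)"
    have "\<omega> (F v) (G v) = - \<omega> v (G (F v))" using c by (simp add: sF)
    also have "\<dots> = - \<omega> (F v) (G v)" using sG[of v "F v"] skew[of "G v" "F v"] by simp
    finally show "poisson \<omega> f g v = 0" by (simp add: P)
  qed
qed

text \<open>
  On a common eigenvector \<open>x\<close> of \<open>F \<circ> F\<close> and \<open>F \<circ> G\<close>, the vectors \<open>F x\<close> and \<open>G x\<close> are parallel,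
  so \<open>x\<close> and \<open>F x\<close> span a plane that is invariant under both maps.
\<close>

lemma simultaneous_invariant_plane:
  assumes f: "pos_def_quadratic_form f" and g: "pos_def_quadratic_form g"
  defines "F \<equiv> assoc_map \<omega> f" and "G \<equiv> assoc_map \<omega> g"
  assumes comm: "\<And>v. F (G v) = G (F v)"
    and W: "subspace W" "W \<noteq> {0}" and inv: "\<And>v. v \<in> W \<Longrightarrow> F v \<in> W" "\<And>v. v \<in> W \<Longrightarrow> G v \<in> W"
  obtains x y \<mu> \<gamma> where "x \<in> W" "y \<in> W" "\<omega> y x = 1" "\<mu> > 0" "\<gamma> > 0"
    "F x = - (\<mu> *\<^sub>R y)" "F y = \<mu> *\<^sub>R x" "G x = - (\<gamma> *\<^sub>R y)" "G y = \<gamma> *\<^sub>R x"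
proof -
  have qf: "quadratic_form f" "quadratic_form g"
    using f g by (auto simp: pos_def_quadratic_form_def)
  have lin: "linear F" "linear G"
    unfolding F_def G_def using assoc_map(1)[OF symplectic] qf by auto
  note lsimps = lin[THEN linear_scale] lin[THEN linear_add] lin[THEN linear_neg]
  have sF: "\<omega> (F v) w = - \<omega> v (F w)" and sG: "\<omega> (G v) w = - \<omega> v (G w)" for v w
    unfolding F_def G_def using qf by (auto intro: assoc_map_skew)
  have f_pos: "0 < \<omega> v (F v)" and g_pos: "0 < \<omega> v (G v)" if "v \<noteq> 0" for v
    using f g qf that unfolding F_def G_def
    by (auto simp: pos_def_quadratic_form_def simp flip: quadratic_form_eq)
  define A where "A = (\<lambda>u v. \<omega> u (F v))"
  have A: "bilinear A"
    unfolding bilinear_def A_def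
    by (auto intro!: linearI simp: omega_simps lsimps)
  have A_sym: "A u v = A v u" for u v
    using skew[of v "F u"] sF[of u v] by (simp add: A_def)
  have A_pos: "0 < A v v" if "v \<noteq> 0" for v using f_pos[OF that] by (simp add: A_def)
  have AF: "A (F u) v = - A u (F v)" for u v by (simp add: A_def sF)
  \<comment> \<open>Commutation enters here: \<open>G\<close> has to be moved past the
    \<open>F\<close> contained in \<open>A\<close>.\<close>
  have AG: "A (G u) v = - A u (G v)" for u v by (simp add: A_def sG comm)

  have ev: "\<exists>x c. x \<in> U \<and> x \<noteq> 0 \<and> S x = c *\<^sub>R x"
    if "linear S" "\<And>u v. A (S u) v = A u (S v)" "subspace U" "\<And>v. v \<in> U \<Longrightarrow> S v \<in> U" "U \<noteq> {0}"
    for S U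
    by (rule symmetric_operator_eigenvector[of A S U, OF A A_sym A_pos that]) blast+
  have lin_FF: "linear (\<lambda>v. F (F v))" and lin_FG: "linear (\<lambda>v. F (G v))"
    using linear_compose[OF lin(1) lin(1)] linear_compose[OF lin(2) lin(1)] by (simp_all add: o_def)
  have sym_FF: "A (F (F u)) v = A u (F (F v))" for u v
    by (simp only: AF minus_minus)
  have sym_FG: "A (F (G u)) v = A u (F (G v))" for u v
    by (simp only: AF AG minus_minus) (simp only: comm)
  have inv_FF: "F (F v) \<in> W" if "v \<in> W" for v using that inv(1) by simp
  obtain x1 c where x1: "x1 \<in> W" "x1 \<noteq> 0" "F (F x1) = c *\<^sub>R x1"
    using ev[OF lin_FF sym_FF W(1) inv_FF W(2)] by blast
  \<comment> \<open>Since \<open>F \<circ> G\<close> commutes with \<open>F \<circ> F\<close>, it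
    preserves this eigenspace, and an eigenvector found inside it serves both operators.\<close>
  define W1 where "W1 = {v \<in> W. F (F v) = c *\<^sub>R v}"
  have W1: "subspace W1" "W1 \<noteq> {0}"
    using W(1) x1 by (auto simp: W1_def subspace_def lsimps algebra_simps linear_0[OF lin(1)])
  have inv_FG: "F (G v) \<in> W1" if "v \<in> W1" for v
    using that inv by (auto simp: W1_def comm lsimps)
  obtain x d where x: "x \<in> W1" "x \<noteq> 0" "F (G x) = d *\<^sub>R x"
    using ev[OF lin_FG sym_FG W1(1) inv_FG W1(2)] by blast
  have xW: "x \<in> W" and FFx: "F (F x) = c *\<^sub>R x" using x(1) by (auto simp: W1_def)

  have a: "A x x > 0" using A_pos[OF x(2)] .
  then have "F x \<noteq> 0" by (auto simp: A_def omega_simps)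
  then have "0 < A (F x) (F x)" by (rule A_pos)
  also have "\<dots> = - c * A x x"
    by (simp only: AF FFx) (simp add: bilinear_rmul[OF A])
  finally have c: "c < 0" using a by (simp add: mult_less_0_iff)
  \<comment> \<open>Both sides equal \<open>F (F (G x))\<close>, computed from the two eigenvector
    equations.\<close>
  have GFFx: "c *\<^sub>R G x = d *\<^sub>R F x"
    using arg_cong[OF FFx, of G] arg_cong[OF x(3), of F] by (simp add: lsimps comm)
  have Gx: "G x = (d / c) *\<^sub>R F x"
    using arg_cong[OF GFFx, of "\<lambda>v. (1 / c) *\<^sub>R v"] c by simp

  \<comment> \<open>On \<open>x\<close>, \<open>F \<circ> F\<close> acts as \<open>- m * m\<close>,
    which forces \<open>Y\<close> to be \<open>F X\<close> divided by \<open>- m\<close>. The scale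
    \<open>r\<close> is chosen to make \<open>\<omega> Y X = 1\<close>, and \<open>l\<close> is read
    off from \<open>G X = - (l *\<^sub>R Y)\<close>.\<close>
  define m where "m = sqrt (- c)"
  have m: "m > 0" and cm: "c = - (m * m)" using c by (auto simp: m_def)
  define r where "r = sqrt (m / A x x)"
  have r: "r > 0" and rr: "r * r * A x x = m" using m a by (auto simp: r_def)
  define X where "X = r *\<^sub>R x"
  define Y where "Y = - (r / m) *\<^sub>R F x"
  define l where "l = - d / m"
  have YX: "\<omega> Y X = 1"
  proof -
    have "\<omega> Y X = r * r * A x x / m"
      by (simp add: Y_def X_def A_def omega_simps sF)
    then show ?thesis using rr m by simp
  qed
  have FX: "F X = - (m *\<^sub>R Y)" and FY: "F Y = m *\<^sub>R X"
    using m by (auto simp: X_def Y_def lsimps FFx cm)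
  have GX: "G X = - (l *\<^sub>R Y)"
    using m by (simp add: X_def Y_def lsimps Gx l_def cm)
  have "G (F x) = d *\<^sub>R x" using x(3) comm by simp
  then have GY: "G Y = l *\<^sub>R X"
    using m by (simp add: X_def Y_def lsimps l_def)
  have "X \<noteq> 0" using r x(2) by (simp add: X_def)
  \<comment> \<open>Here \<open>\<omega> X (G X) = l\<close>, because
    \<open>\<omega> X Y = - 1\<close>.\<close>
  from g_pos[OF this] have "l > 0"
    using YX skew[of X Y] by (simp add: GX omega_simps)
  moreover have "X \<in> W" "Y \<in> W"
    using xW inv W(1) by (auto simp: X_def Y_def subspace_scale subspace_neg)
  ultimately show thesis using that YX m FX FY GX GY by blast
qed

section \<open>Partial symplectic bases\<close>

text \<open>These are the relations of a symplectic basis without spanning or independence, so that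
  a family can grow by one plane at a time.\<close>

definition symplectic_family :: "nat \<Rightarrow> (nat \<Rightarrow> 'a) \<Rightarrow> (nat \<Rightarrow> 'a) \<Rightarrow> bool" where
  "symplectic_family k x y \<longleftrightarrow> (\<forall>i\<in>{1..k}. \<forall>j\<in>{1..k}.
     \<omega> (y i) (x j) = (if i = j then 1 else 0) \<and> \<omega> (x i) (x j) = 0 \<and> \<omega> (y i) (y j) = 0)"

lemma symplectic_familyD:
  assumes "symplectic_family k x y" "i \<in> {1..k}" "j \<in> {1..k}"
  shows "\<omega> (y i) (x j) = (if i = j then 1 else 0)" "\<omega> (x i) (y j) = (if i = j then - 1 else 0)"
    "\<omega> (x i) (x j) = 0" "\<omega> (y i) (y j) = 0"
  using assms skew[of "x i" "y j"] by (auto simp: symplectic_family_def)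

text \<open>Pairing with the partner vector recovers a coordinate; the sign for \<open>t i\<close>
  reflects \<open>\<omega> (x i) (y i) = - 1\<close>.\<close>

lemma omega_family_sum:
  assumes fam: "symplectic_family k x y" and i: "i \<in> {1..k}"
  shows "\<omega> (y i) (\<Sum>j=1..k. s j *\<^sub>R x j + t j *\<^sub>R y j) = s i"
    and "\<omega> (x i) (\<Sum>j=1..k. s j *\<^sub>R x j + t j *\<^sub>R y j) = - t i"
proof -
  have "\<omega> (y i) (\<Sum>j=1..k. s j *\<^sub>R x j + t j *\<^sub>R y j) = (\<Sum>j=1..k. if i = j then s j else 0)"
    unfolding linear_sum[OF linear_right]
    by (intro sum.cong) (use symplectic_familyD[OF fam i] in \<open>auto simp: omega_simps\<close>)
  then show "\<omega> (y i) (\<Sum>j=1..k. s j *\<^sub>R x j + t j *\<^sub>R y j) = s i" using i by simp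
  have "\<omega> (x i) (\<Sum>j=1..k. s j *\<^sub>R x j + t j *\<^sub>R y j) = (\<Sum>j=1..k. if i = j then - t j else 0)"
    unfolding linear_sum[OF linear_right]
    by (intro sum.cong) (use symplectic_familyD[OF fam i] in \<open>auto simp: omega_simps\<close>)
  then show "\<omega> (x i) (\<Sum>j=1..k. s j *\<^sub>R x j + t j *\<^sub>R y j) = - t i" using i by simp
qed

text \<open>The partner of a member pairs to zero with every other member, hence with their span,
  but not with the member itself.\<close>

lemma symplectic_family_independent:
  assumes fam: "symplectic_family k x y"
  shows "independent (x ` {1..k} \<union> y ` {1..k})"
proof -
  have 0: "\<omega> w v = 0" if "v \<in> span B" "\<And>b. b \<in> B \<Longrightarrow> \<omega> w b = 0" for w v B
    using linear_eq_0_on_span[OF linear_right _ that(1)] that(2) by blast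
  note fD = symplectic_familyD[OF fam]
  show ?thesis
    unfolding dependent_def
  proof
    assume "\<exists>a\<in>x ` {1..k} \<union> y ` {1..k}. a \<in> span (x ` {1..k} \<union> y ` {1..k} - {a})"
    then obtain j where j: "j \<in> {1..k}" and
      "x j \<in> span (x ` {1..k} \<union> y ` {1..k} - {x j}) \<or> y j \<in> span (x ` {1..k} \<union> y ` {1..k} - {y j})"
      by blast
    then show False
    proof (elim disjE)
      assume "x j \<in> span (x ` {1..k} \<union> y ` {1..k} - {x j})"
      then have "\<omega> (y j) (x j) = 0"
        by (rule 0) (use fD j in \<open>auto split: if_splits\<close>)
      then show False using fD(1)[OF j j] by simp
    next
      assume "y j \<in> span (x ` {1..k} \<union> y ` {1..k} - {y j})"
      then have "\<omega> (x j) (y j) = 0"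
        by (rule 0) (use fD j in \<open>auto split: if_splits\<close>)
      then show False using fD(2)[OF j j] by simp
    qed
  qed
qed

lemma symplectic_family_card:
  assumes fam: "symplectic_family k x y"
  shows "card (x ` {1..k} \<union> y ` {1..k}) = 2 * k"
proof -
  note fD = symplectic_familyD[OF fam]
  have "inj_on x {1..k}"
    by (rule inj_onI) (metis fD(1) zero_neq_one)
  moreover have "inj_on y {1..k}"
    by (rule inj_onI) (metis fD(1) zero_neq_one)
  moreover have "x ` {1..k} \<inter> y ` {1..k} = {}"
    using fD(1,4) by (smt (verit) disjoint_iff imageE)
  ultimately show ?thesis
    by (subst card_Un_disjoint) (auto simp: card_image)
qed

text \<open>The relations force \<open>2 * n\<close> distinct independent vectors, which fill the
  whole space by dimension.\<close>

lemma symplectic_basis_iff: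
  assumes "DIM('a) = 2 * n"
  shows "symplectic_basis \<omega> n x y \<longleftrightarrow> symplectic_family n x y"
proof
  assume fam: "symplectic_family n x y"
  note ind = symplectic_family_independent[OF fam]
  have "UNIV \<subseteq> span (x ` {1..n} \<union> y ` {1..n})"
    by (rule card_ge_dim_independent) (use ind assms symplectic_family_card[OF fam] in auto)
  then show "symplectic_basis \<omega> n x y"
    using fam ind by (auto simp: symplectic_basis_def symplectic_family_def)
qed (auto simp: symplectic_basis_def symplectic_family_def)

lemma symplectic_family_projection:
  fixes k x y v
  defines "r \<equiv> v - (\<Sum>j=1..k. \<omega> (y j) v *\<^sub>R x j + (- \<omega> (x j) v) *\<^sub>R y j)"
  assumes fam: "symplectic_family k x y" and i: "i \<in> {1..k}"
  shows "\<omega> (x i) r = 0" "\<omega> (y i) r = 0"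
  unfolding r_def omega_simps omega_family_sum[OF fam i] by simp_all

text \<open>The remainder of the projection is \<open>\<omega>\<close>-orthogonal to a spanning set,
  hence zero by nondegeneracy.\<close>

lemma symplectic_basis_expand:
  assumes "DIM('a) = 2 * n" and fam: "symplectic_family n x y"
  shows "v = (\<Sum>j=1..n. \<omega> (y j) v *\<^sub>R x j + (- \<omega> (x j) v) *\<^sub>R y j)" (is "v = ?s")
proof -
  have sp: "span (x ` {1..n} \<union> y ` {1..n}) = UNIV"
    using symplectic_basis_iff[OF assms(1), of x y] fam unfolding symplectic_basis_def by blast
  have "v - ?s = 0"
  proof (rule nondegenerate)
    fix u
    have "\<omega> u (v - ?s) = 0"
      by (rule linear_eq_0_on_span[OF linear_left, of "x ` {1..n} \<union> y ` {1..n}"])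
        (use sp symplectic_family_projection[OF fam] in auto)
    then show "\<omega> u (v - ?s) = \<omega> u 0" by (simp add: omega_simps)
  qed
  then show ?thesis by simp
qed

section \<open>Construction of the normal form\<close>

text \<open>Induction on the number of planes lets each step split off an invariant plane from the
  \<open>\<omega>\<close>-orthogonal complement of the earlier ones.\<close>

lemma simultaneous_partial_normal_form:
  assumes f: "pos_def_quadratic_form f" and g: "pos_def_quadratic_form g"
  defines "F \<equiv> assoc_map \<omega> f" and "G \<equiv> assoc_map \<omega> g"
  assumes comm: "\<And>v. F (G v) = G (F v)" and "2 * k \<le> DIM('a)"
  shows "\<exists>x y \<mu> \<gamma>. symplectic_family k x y \<and> (\<forall>j\<in>{1..k}. \<mu> j > 0 \<and> \<gamma> j > 0 \<and>
     F (x j) = - (\<mu> j *\<^sub>R y j) \<and> F (y j) = \<mu> j *\<^sub>R x j \<and>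
     G (x j) = - (\<gamma> j *\<^sub>R y j) \<and> G (y j) = \<gamma> j *\<^sub>R x j)"
  using \<open>2 * k \<le> DIM('a)\<close>
proof (induction k)
  case 0
  then show ?case by (simp add: symplectic_family_def)
next
  case (Suc k)
  then have "2 * k \<le> DIM('a)" by simp
  from Suc.IH[OF this] obtain x y \<mu> \<gamma> where fam: "symplectic_family k x y"
    and nf: "\<And>j. j \<in> {1..k} \<Longrightarrow> \<mu> j > 0 \<and> \<gamma> j > 0 \<and>
     F (x j) = - (\<mu> j *\<^sub>R y j) \<and> F (y j) = \<mu> j *\<^sub>R x j \<and>
     G (x j) = - (\<gamma> j *\<^sub>R y j) \<and> G (y j) = \<gamma> j *\<^sub>R x j"
    by blast
  have qf: "quadratic_form f" "quadratic_form g"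
    using f g by (auto simp: pos_def_quadratic_form_def)
  have sF: "\<omega> v (F w) = - \<omega> (F v) w" and sG: "\<omega> v (G w) = - \<omega> (G v) w" for v w
    unfolding F_def G_def using qf by (auto simp: assoc_map_skew)
  define W where "W = {w. \<forall>j\<in>{1..k}. \<omega> (x j) w = 0 \<and> \<omega> (y j) w = 0}"
  have W: "subspace W"
    by (auto simp: W_def subspace_def omega_simps)
  \<comment> \<open>If \<open>W\<close> were zero, every vector would equal its projection, so the
    \<open>2 * k\<close> family members would span a space of dimension at least
    \<open>2 * Suc k\<close>.\<close>
  have W0: "W \<noteq> {0}"
  proof
    assume W0: "W = {0}"
    have "v \<in> span (x ` {1..k} \<union> y ` {1..k})" for v
    proof -
      have "v - (\<Sum>j=1..k. \<omega> (y j) v *\<^sub>R x j + (- \<omega> (x j) v) *\<^sub>R y j) \<in> W"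
        unfolding W_def using symplectic_family_projection[OF fam, of _ v] by simp
      then have "v = (\<Sum>j=1..k. \<omega> (y j) v *\<^sub>R x j + (- \<omega> (x j) v) *\<^sub>R y j)"
        using W0 by simp
      also have "\<dots> \<in> span (x ` {1..k} \<union> y ` {1..k})"
        by (intro span_sum span_add span_scale span_base) auto
      finally show ?thesis .
    qed
    then have "DIM('a) \<le> card (x ` {1..k} \<union> y ` {1..k})"
      by (subst dim_UNIV[symmetric], intro dim_le_card) auto
    then show False using symplectic_family_card[OF fam] Suc.prems by simp
  qed
  \<comment> \<open>Skewness shifts the map onto a family member, which it sends to a multiple of
    the partner.\<close>
  have FW: "F v \<in> W" and GW: "G v \<in> W" if "v \<in> W" for v
    using that nf by (auto simp: W_def sF sG omega_simps)
  obtain a b m l where ab: "a \<in> W" "b \<in> W" "\<omega> b a = 1" and ml: "m > 0" "l > 0"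
    and FG: "F a = - (m *\<^sub>R b)" "F b = m *\<^sub>R a" "G a = - (l *\<^sub>R b)" "G b = l *\<^sub>R a"
    using simultaneous_invariant_plane[OF f g, folded F_def G_def, OF comm W W0 FW GW] by blast
  have orth: "\<omega> (x j) a = 0" "\<omega> (y j) a = 0" "\<omega> (x j) b = 0" "\<omega> (y j) b = 0"
    "\<omega> a (x j) = 0" "\<omega> a (y j) = 0" "\<omega> b (x j) = 0" "\<omega> b (y j) = 0" if "j \<in> {1..k}" for j
    using that ab(1,2) skew[of a "x j"] skew[of a "y j"] skew[of b "x j"] skew[of b "y j"]
    by (auto simp: W_def)
  have "symplectic_family (Suc k) (x(Suc k := a)) (y(Suc k := b))"
    using symplectic_familyD[OF fam] orth ab(3)
    by (auto simp: symplectic_family_def le_Suc_eq)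
  moreover have "\<forall>j\<in>{1..Suc k}. (\<mu>(Suc k := m)) j > 0 \<and> (\<gamma>(Suc k := l)) j > 0 \<and>
     F ((x(Suc k := a)) j) = - ((\<mu>(Suc k := m)) j *\<^sub>R (y(Suc k := b)) j) \<and>
     F ((y(Suc k := b)) j) = (\<mu>(Suc k := m)) j *\<^sub>R (x(Suc k := a)) j \<and>
     G ((x(Suc k := a)) j) = - ((\<gamma>(Suc k := l)) j *\<^sub>R (y(Suc k := b)) j) \<and>
     G ((y(Suc k := b)) j) = (\<gamma>(Suc k := l)) j *\<^sub>R (x(Suc k := a)) j"
    using nf ml FG by (auto simp: le_Suc_eq)
  ultimately show ?case by blast
qed

section \<open>Values and eigenvalues in normal form\<close>

text \<open>Since \<open>f v = - \<omega> (F v) v\<close>, expanding only \<open>F v\<close> leaves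
  pairings of basis vectors with \<open>v\<close>, which are the coordinates up to sign.\<close>

lemma normal_form_value:
  assumes f: "quadratic_form f" and fam: "symplectic_family n x y"
  defines "F \<equiv> assoc_map \<omega> f"
  assumes nf: "\<And>j. j \<in> {1..n} \<Longrightarrow> F (x j) = - (\<mu> j *\<^sub>R y j) \<and> F (y j) = \<mu> j *\<^sub>R x j"
  shows "f (\<Sum>j=1..n. s j *\<^sub>R x j + t j *\<^sub>R y j) = (\<Sum>j=1..n. \<mu> j * ((s j)\<^sup>2 + (t j)\<^sup>2))"
proof -
  define v where "v = (\<Sum>j=1..n. s j *\<^sub>R x j + t j *\<^sub>R y j)"
  have lin: "linear F" unfolding F_def using assoc_map(1)[OF symplectic f] .
  have "F v = (\<Sum>j=1..n. (\<mu> j * t j) *\<^sub>R x j - (\<mu> j * s j) *\<^sub>R y j)"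
    unfolding v_def linear_sum[OF lin]
    by (intro sum.cong) (simp_all add: linear_add[OF lin] linear_scale[OF lin] nf mult.commute)
  then have "\<omega> (F v) v = (\<Sum>j=1..n. \<mu> j * t j * \<omega> (x j) v - \<mu> j * s j * \<omega> (y j) v)"
    by (simp only: linear_sum[OF linear_left]) (simp add: omega_simps)
  also have "\<dots> = (\<Sum>j=1..n. - (\<mu> j * ((s j)\<^sup>2 + (t j)\<^sup>2)))"
    unfolding v_def
    by (intro sum.cong refl)
      (simp only: omega_family_sum[OF fam], simp add: power2_eq_square algebra_simps)
  finally have "\<omega> (F v) v = - (\<Sum>j=1..n. \<mu> j * ((s j)\<^sup>2 + (t j)\<^sup>2))"
    by (simp only: sum_negf)
  moreover have "f v = - \<omega> (F v) v"
    unfolding F_def using quadratic_form_eq[OF f, of v] assoc_map_skew[OF f, of v v] by linarith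
  ultimately show ?thesis by (simp add: v_def)
qed

text \<open>
  The vectors \<open>x\<^sub>j \<plusminus> \<i> y\<^sub>j\<close> form a basis of the complexification, and they are eigenvectors of \<open>F\<close>
  for \<open>\<plusminus> \<i> \<mu>\<^sub>j\<close>. The sign is recorded as a real number \<open>\<sigma>\<close>; the functional dual to
  \<open>x\<^sub>j + \<i> \<sigma> y\<^sub>j\<close> is half the difference of the \<open>x\<^sub>j\<close>-coordinate and \<open>\<i> \<sigma>\<close> times the
  \<open>y\<^sub>j\<close>-coordinate.
\<close>

lemma normal_form_eigenvalues:
  assumes dim: "DIM('a) = 2 * n" and f: "quadratic_form f" and fam: "symplectic_family n x y"
  defines "F \<equiv> assoc_map \<omega> f"
  assumes nf: "\<And>j. j \<in> {1..n} \<Longrightarrow> F (x j) = - (\<mu> j *\<^sub>R y j) \<and> F (y j) = \<mu> j *\<^sub>R x j"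
  shows "eigenvalue_list F (plus_minus_i n \<mu>)"
proof -
  define I where "I = {1..n} \<times> {1, - 1 :: real}"
  define e where "e = (\<lambda>(j, \<sigma>). (x j, \<sigma> *\<^sub>R y j))"
  define l where "l = (\<lambda>(j, \<sigma>). \<i> * of_real (\<sigma> * \<mu> j))"
  define S where "S = (\<lambda>j w. Complex (\<omega> (y j) (fst w)) (\<omega> (y j) (snd w)))"
  define T where "T = (\<lambda>j w. Complex (- \<omega> (x j) (fst w)) (- \<omega> (x j) (snd w)))"
  define \<phi> where "\<phi> = (\<lambda>(j, \<sigma>) w. (S j w - \<i> * of_real \<sigma> * T j w) / 2)"
  note fD = symplectic_familyD[OF fam]
  have skewF: "\<omega> u (F v) = - \<omega> (F u) v" for u v
    unfolding F_def assoc_map_skew[OF f] by simp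
  have fin: "finite I" by (simp add: I_def)
  have "eigenvalue_list F (image_mset l (mset_set I))"
  proof (rule eigenvalue_list_diagonalizable[OF fin])
    fix i assume "i \<in> I"
    have "module_hom cscale (*) (\<phi> (j, \<sigma>))" for j \<sigma>
      by unfold_locales
        (auto simp: \<phi>_def S_def T_def cscale_def complex_eq_iff omega_simps algebra_simps
          add_divide_distrib diff_divide_distrib)
    then show "module_hom cscale (*) (\<phi> i)" by (cases i) simp
  next
    fix i k assume "i \<in> I" "k \<in> I"
    then show "\<phi> i (e k) = (if i = k then 1 else 0)"
      by (auto simp: I_def \<phi>_def e_def S_def T_def complex_eq_iff omega_simps fD split: if_splits)
  next
    fix w :: "'a \<times> 'a"
    \<comment> \<open>The two signs belonging to one \<open>j\<close> are added first: the result
      has the complex coefficients \<open>S j w\<close> on \<open>x j\<close> and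
      \<open>T j w\<close> on \<open>y j\<close>.\<close>
    have "cscale (\<phi> (j, 1) w) (e (j, 1)) + cscale (\<phi> (j, - 1) w) (e (j, - 1)) =
        (\<omega> (y j) (fst w) *\<^sub>R x j + (- \<omega> (x j) (fst w)) *\<^sub>R y j,
         \<omega> (y j) (snd w) *\<^sub>R x j + (- \<omega> (x j) (snd w)) *\<^sub>R y j)" for j
      by (rule prod_eqI; rule euclidean_eqI)
        (simp_all add: \<phi>_def e_def cscale_def S_def T_def inner_simps field_simps)
    then have "(\<Sum>i\<in>I. cscale (\<phi> i w) (e i)) =
        (\<Sum>j=1..n. (\<omega> (y j) (fst w) *\<^sub>R x j + (- \<omega> (x j) (fst w)) *\<^sub>R y j,
         \<omega> (y j) (snd w) *\<^sub>R x j + (- \<omega> (x j) (snd w)) *\<^sub>R y j))"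
      unfolding I_def sum.cartesian_product' by simp
    then show "w = (\<Sum>i\<in>I. cscale (\<phi> i w) (e i))"
      using symplectic_basis_expand[OF dim fam, of "fst w"]
        symplectic_basis_expand[OF dim fam, of "snd w"]
      by (simp only: sum_prod prod_eq_iff fst_conv snd_conv)
  next
    fix i w assume "i \<in> I"
    then obtain j \<sigma> where i: "i = (j, \<sigma>)" and j: "j \<in> {1..n}" and \<sigma>: "\<sigma> = 1 \<or> \<sigma> = - 1"
      by (auto simp: I_def)
    \<comment> \<open>\<open>F\<close> exchanges the two coordinates up to a factor, and
      \<open>\<sigma> * \<sigma> = 1\<close> makes the combination
      \<open>\<phi> (j, \<sigma>)\<close> an eigenfunctional.\<close>
    have "S j (complexify F w) = of_real (\<mu> j) * T j w" "T j (complexify F w) = - of_real (\<mu> j) * S j w"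
      using nf[OF j] by (simp_all add: S_def T_def complexify_def complex_eq_iff skewF omega_simps)
    then show "\<phi> i (complexify F w) = l i * \<phi> i w"
      using \<sigma> by (auto simp: i \<phi>_def l_def field_simps)
  qed
  moreover have "image_mset l (mset_set I) = plus_minus_i n \<mu>"
  proof -
    have "I = (\<lambda>j. (j, 1)) ` {1..n} \<union> (\<lambda>j. (j, - 1)) ` {1..n}"
      by (auto simp: I_def)
    then have "mset_set I = image_mset (\<lambda>j. (j, 1)) (mset_set {1..n}) +
        image_mset (\<lambda>j. (j, - 1)) (mset_set {1..n})"
      by (simp add: image_mset_mset_set inj_on_def, subst mset_set_Union) auto
    then show ?thesis
      by (simp add: plus_minus_i_def l_def multiset.map_comp o_def)
  qed
  ultimately show ?thesis by simp
qed

end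

theorem theorem3p3:
  fixes \<omega> :: "'a::euclidean_space \<Rightarrow> 'a \<Rightarrow> real"
    and f g :: "'a \<Rightarrow> real" and F G :: "'a \<Rightarrow> 'a" and n :: nat
  assumes "DIM('a) = 2 * n"
    and "symplectic_form \<omega>"
    and "pos_def_quadratic_form f" and "pos_def_quadratic_form g"
    and "F = assoc_map \<omega> f" and "G = assoc_map \<omega> g"
  shows "((\<forall>v. poisson \<omega> f g v = 0) \<longleftrightarrow>
           (\<exists>x y \<mu> \<gamma>. simultaneous_normal_form \<omega> n F G x y \<mu> \<gamma>)) \<and>
         (\<forall>x y \<mu> \<gamma>. simultaneous_normal_form \<omega> n F G x y \<mu> \<gamma> \<longrightarrow>
           eigenvalue_list F (plus_minus_i n \<mu>) \<and>
           eigenvalue_list G (plus_minus_i n \<gamma>) \<and>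
           (\<forall>s t :: nat \<Rightarrow> real.
              f (\<Sum>j=1..n. s j *\<^sub>R x j + t j *\<^sub>R y j) = (\<Sum>j=1..n. \<mu> j * ((s j)\<^sup>2 + (t j)\<^sup>2)) \<and>
              g (\<Sum>j=1..n. s j *\<^sub>R x j + t j *\<^sub>R y j) = (\<Sum>j=1..n. \<gamma> j * ((s j)\<^sup>2 + (t j)\<^sup>2))))"
proof -
  interpret symplectic_space \<omega> by unfold_locales (rule assms(2))
  have qf: "quadratic_form f" "quadratic_form g"
    using assms(3,4) by (auto simp: pos_def_quadratic_form_def)
  note FG = assms(5,6)
  have lin: "linear F" "linear G"
    unfolding FG using assoc_map(1)[OF symplectic] qf by auto
  note comm_iff = poisson_commute_iff[OF qf, folded FG]
  have nf_iff: "simultaneous_normal_form \<omega> n F G x y \<mu> \<gamma> \<longleftrightarrow>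
     symplectic_family n x y \<and> (\<forall>j\<in>{1..n}. \<mu> j > 0 \<and> \<gamma> j > 0 \<and>
        F (x j) = - (\<mu> j *\<^sub>R y j) \<and> F (y j) = \<mu> j *\<^sub>R x j \<and>
        G (x j) = - (\<gamma> j *\<^sub>R y j) \<and> G (y j) = \<gamma> j *\<^sub>R x j)" for x y \<mu> \<gamma>
    unfolding simultaneous_normal_form_def symplectic_basis_iff[OF assms(1)] ..
  show ?thesis
  proof (intro conjI iffI allI impI)
    assume "\<forall>v. poisson \<omega> f g v = 0"
    then have "F (G v) = G (F v)" for v using comm_iff by blast
    then show "\<exists>x y \<mu> \<gamma>. simultaneous_normal_form \<omega> n F G x y \<mu> \<gamma>"
      unfolding nf_iff
      by (rule simultaneous_partial_normal_form[OF assms(3,4), folded FG])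
        (simp_all add: assms(1))
  next
    fix v
    assume "\<exists>x y \<mu> \<gamma>. simultaneous_normal_form \<omega> n F G x y \<mu> \<gamma>"
    then obtain x y \<mu> \<gamma> where nf: "simultaneous_normal_form \<omega> n F G x y \<mu> \<gamma>" by blast
    \<comment> \<open>On the plane of \<open>x j\<close> and \<open>y j\<close> both compositions
      are multiplication by \<open>- \<mu> j * \<gamma> j\<close>, so they agree on a basis.\<close>
    have "F (G v) = G (F v)" for v
    proof (rule linear_eq_on_span[of "\<lambda>v. F (G v)" "\<lambda>v. G (F v)" "x ` {1..n} \<union> y ` {1..n}"])
      show "linear (\<lambda>v. F (G v))" "linear (\<lambda>v. G (F v))"
        using linear_compose lin by (auto simp: o_def)
      show "v \<in> span (x ` {1..n} \<union> y ` {1..n})"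
        using nf by (simp add: simultaneous_normal_form_def symplectic_basis_def)
      show "F (G b) = G (F b)" if "b \<in> x ` {1..n} \<union> y ` {1..n}" for b
        using that nf
        by (auto simp: simultaneous_normal_form_def linear_neg lin linear_scale mult.commute)
    qed
    then show "poisson \<omega> f g v = 0" using comm_iff by blast
  next
    fix x y \<mu> \<gamma> and s t :: "nat \<Rightarrow> real"
    assume "simultaneous_normal_form \<omega> n F G x y \<mu> \<gamma>"
    then have fam: "symplectic_family n x y"
      and F: "\<And>j. j \<in> {1..n} \<Longrightarrow> F (x j) = - (\<mu> j *\<^sub>R y j) \<and> F (y j) = \<mu> j *\<^sub>R x j"
      and G: "\<And>j. j \<in> {1..n} \<Longrightarrow> G (x j) = - (\<gamma> j *\<^sub>R y j) \<and> G (y j) = \<gamma> j *\<^sub>R x j"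
      unfolding nf_iff by blast+
    show "eigenvalue_list F (plus_minus_i n \<mu>)"
      unfolding FG by (rule normal_form_eigenvalues[OF assms(1) qf(1) fam F[unfolded FG]])
    show "eigenvalue_list G (plus_minus_i n \<gamma>)"
      unfolding FG by (rule normal_form_eigenvalues[OF assms(1) qf(2) fam G[unfolded FG]])
    show "f (\<Sum>j=1..n. s j *\<^sub>R x j + t j *\<^sub>R y j) = (\<Sum>j=1..n. \<mu> j * ((s j)\<^sup>2 + (t j)\<^sup>2))"
      by (rule normal_form_value[OF qf(1) fam F[unfolded FG]])
    show "g (\<Sum>j=1..n. s j *\<^sub>R x j + t j *\<^sub>R y j) = (\<Sum>j=1..n. \<gamma> j * ((s j)\<^sup>2 + (t j)\<^sup>2))"
      by (rule normal_form_value[OF qf(2) fam G[unfolded FG]])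
  qed
qed

end
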